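(* Let $n\in\mathbb{N}$, $p\in[0,1]$, $q=1-p$, and let $\alpha=(\alpha_1,\dots,\alpha_n)\in[n]^n$ satisfy $\alpha_i\le i$ for all $i\in[n]$. Under the probabilistic parking protocol with open boundaries and initial preferences $\alpha$, the probability that all of the cars park is $$\Pr[X_\alpha=1]=\begin{cases}\displaystyle\prod_{k=1}^n\frac{\alpha_k}{k} & \text{if }p=\tfrac12,\\[3mm] \displaystyle\prod_{k=1}^n p^{\,k-\alpha_k}\,\frac{p^{\alpha_k}-q^{\alpha_k}}{p^k-q^k} & \text{otherwise.}\end{cases}$$
   Context: $[n]=\{1,\dots,n\}$; the convention $0^0=1$ is used. Preference lists with $\alpha_i\le i$ for all $i$ are exactly the parking functions whose classical outcome is the identity permutation. Probabilistic parking protocol with open boundary: cars $1,2,\dots,n$ arrive one at a time in this order, each entering after its predecessor has finished its search. Car $i$ starts at spot $\alpha_i$ and performs a nearest-neighbour random walk (independent of the walks of the other cars), each step being $+1$ with probability $p$ and $-1$ with probability $q=1-p$, until it either first visits an unoccupied spot of $[n]$, where it parks immediately (in zero steps if $\alpha_i$ is unoccupied), or leaves $[n]$ (enters $0$ or $n+1$), in which case its search terminates and it does not park. $X_\alpha$ is the indicator that all $n$ cars park. *)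

theory Defs
  imports "HOL-Probability.Probability"
begin

text \<open>Spots are integers, so that the walk can also be at the exits \<open>0\<close> and \<open>n + 1\<close>.
  A step stream \<open>w\<close> encodes \<open>+1\<close> by \<^term>\<open>True\<close> and \<open>-1\<close> by \<^term>\<open>False\<close>.\<close>

definition walk :: "int \<Rightarrow> bool stream \<Rightarrow> nat \<Rightarrow> int" where
  "walk a w t = a + (\<Sum>s<t. if w !! s then 1 else -1)"

definition search_ends :: "nat \<Rightarrow> int set \<Rightarrow> int \<Rightarrow> bool" where
  "search_ends n occ x \<longleftrightarrow> x \<in> {1..int n} - occ \<or> x \<notin> {1..int n}"

text \<open>The spot taken by a car with preference \<open>a\<close> when the spots in \<open>occ\<close> are occupied;
  \<^term>\<open>None\<close> if the car leaves the street, or if its search never ends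
  (the latter is an event of probability zero).\<close>

definition park :: "nat \<Rightarrow> int set \<Rightarrow> int \<Rightarrow> bool stream \<Rightarrow> int option" where
  "park n occ a w =
    (if \<exists>t. search_ends n occ (walk a w t)
     then let x = walk a w (LEAST t. search_ends n occ (walk a w t))
          in if x \<in> {1..int n} then Some x else None
     else None)"

text \<open>The set of spots occupied after cars \<open>1, \<dots>, i\<close> have finished their searches.\<close>

fun occupied :: "nat \<Rightarrow> (nat \<Rightarrow> nat) \<Rightarrow> (nat \<Rightarrow> bool stream) \<Rightarrow> nat \<Rightarrow> int set" where
  "occupied n \<alpha> \<omega> 0 = {}"
| "occupied n \<alpha> \<omega> (Suc i) =
    occupied n \<alpha> \<omega> i \<union>
    set_option (park n (occupied n \<alpha> \<omega> i) (int (\<alpha> (Suc i))) (\<omega> (Suc i)))"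

definition car_parks :: "nat \<Rightarrow> (nat \<Rightarrow> nat) \<Rightarrow> (nat \<Rightarrow> bool stream) \<Rightarrow> nat \<Rightarrow> bool" where
  "car_parks n \<alpha> \<omega> i \<longleftrightarrow> park n (occupied n \<alpha> \<omega> (i - 1)) (int (\<alpha> i)) (\<omega> i) \<noteq> None"

definition X :: "nat \<Rightarrow> (nat \<Rightarrow> nat) \<Rightarrow> (nat \<Rightarrow> bool stream) \<Rightarrow> nat" where
  "X n \<alpha> \<omega> = (if \<forall>i\<in>{1..n}. car_parks n \<alpha> \<omega> i then 1 else 0)"

text \<open>Independent streams, one per car, of i.i.d. steps that are \<^term>\<open>True\<close> with
  probability \<open>p\<close>.\<close>

definition steps_space :: "nat \<Rightarrow> real \<Rightarrow> (nat \<Rightarrow> bool stream) measure" where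
  "steps_space n p = PiM {1..n} (\<lambda>_. stream_space (measure_pmf (bernoulli_pmf p)))"

end

theory Submission
  imports Defs
begin

text \<open>
  As long as every car so far has parked, the occupied spots form an initial segment: the first
  car has \<open>\<alpha> 1 = 1\<close>, and if cars \<open>1, \<dots>, i\<close> fill \<open>{1..i}\<close>, then car \<open>i + 1\<close>, starting at
  \<open>\<alpha> (i + 1) \<le> i + 1\<close>, can leave \<open>{1..i}\<close> only through the exit \<open>0\<close> or into the free spot \<open>i + 1\<close>
  (lemma \<open>park_behind_full_segment\<close>). Hence all cars park iff, for each \<open>k\<close>, the walk of car \<open>k\<close>
  reaches \<open>k\<close> before \<open>0\<close>. These events concern different walks, so they are independent and the
  probability is a product of gambler's ruin probabilities.

  For the probability \<open>h a\<close> of reaching \<open>k\<close> before \<open>0\<close> from \<open>a\<close>, the first step gives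
  \<open>h a = p * h (a + 1) + q * h (a - 1)\<close>, that is, the increments \<open>d j = h (j + 1) - h j\<close> satisfy
  \<open>p * d j = q * d (j - 1)\<close>. They are therefore proportional to the weights \<open>p^(k-1-j) * q^j\<close>, and
  \<open>h 0 = 0\<close>, \<open>h k = 1\<close> determine \<open>h\<close> as a quotient of partial sums of these weights (lemma
  \<open>harmonic_on_segment\<close>). Working with these homogeneous weights rather than with powers of
  \<open>q / p\<close> treats \<open>p = 0\<close> and \<open>p = 1 / 2\<close> together with the generic case. A search that never
  ends counts as a failure in \<open>h\<close>, as it does in \<open>park\<close>; the recursion and the two boundary
  values hold for this \<open>h\<close> exactly and leave only one candidate.
\<close>

section \<open>Harmonic functions on a segment\<close>

definition ruin_weight_sum :: "real \<Rightarrow> real \<Rightarrow> nat \<Rightarrow> nat \<Rightarrow> real" where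
  "ruin_weight_sum p q k a = (\<Sum>j<a. p ^ (k - Suc j) * q ^ j)"

text \<open>
  Iterating \<open>p * d j = q * d (j - 1)\<close> and clearing denominators yields the symmetric relation
  \<open>w i * d j = w j * d i\<close> with \<open>w j = p^(k-1-j) * q^j\<close>; summing it over \<open>i < k\<close> and \<open>j < a\<close> makes
  both sums of increments telescope.
\<close>

lemma harmonic_on_segment:
  fixes h :: "nat \<Rightarrow> real" and p q :: real
  assumes pq: "p + q = 1"
    and h0: "h 0 = 0"
    and harmonic: "\<And>a. 0 < a \<Longrightarrow> a < k \<Longrightarrow> h a = p * h (Suc a) + q * h (a - 1)"
    and ak: "a \<le> k"
  shows "ruin_weight_sum p q k k * h a = ruin_weight_sum p q k a * h k"
proof -
  define d where "d j = h (Suc j) - h j" for j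
  define w where "w j = p ^ (k - Suc j) * q ^ j" for j
  have step: "p * d (Suc j) = q * d j" if "Suc j < k" for j
  proof -
    have "(p + q) * h (Suc j) = p * h (Suc (Suc j)) + q * h j"
      using harmonic[of "Suc j"] that pq by simp
    then show ?thesis
      by (simp add: d_def algebra_simps)
  qed
  have iter: "p ^ m * d (i + m) = q ^ m * d i" if "i + m < k" for i m
    using that
  proof (induction m)
    case (Suc m)
    have "p ^ Suc m * d (i + Suc m) = p ^ m * (p * d (Suc (i + m)))"
      by (simp add: ac_simps)
    also have "\<dots> = q * (p ^ m * d (i + m))"
      using step[of "i + m"] Suc.prems by (simp add: ac_simps)
    also have "\<dots> = q ^ Suc m * d i"
      using Suc by (simp add: ac_simps)
    finally show ?case .
  qed simp
  have ordered: "w i * d j = w j * d i" if le: "i \<le> j" "j < k" for i j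
  proof -
    obtain m where m: "j = i + m"
      using le_Suc_ex[OF le(1)] by blast
    have "k - Suc i = (k - Suc j) + m"
      using le m by simp
    then have "w i * d j = p ^ (k - Suc j) * q ^ i * (p ^ m * d (i + m))"
      by (simp add: w_def m power_add)
    also have "\<dots> = w j * d i"
      using iter[of i m] le m by (simp add: w_def power_add)
    finally show ?thesis .
  qed
  have symmetric: "w i * d j = w j * d i" if "i < k" "j < k" for i j
    using ordered[of i j] ordered[of j i] that by (cases "i \<le> j") auto
  have telescope: "(\<Sum>j<b. d j) = h b" for b
    using sum_lessThan_telescope[of h b] by (simp add: d_def h0)
  have "ruin_weight_sum p q k k * h a = (\<Sum>i<k. \<Sum>j<a. w i * d j)"
    by (simp add: ruin_weight_sum_def w_def sum_product flip: telescope)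
  also have "\<dots> = (\<Sum>i<k. \<Sum>j<a. w j * d i)"
    using ak by (intro sum.cong refl symmetric) auto
  also have "\<dots> = (\<Sum>j<a. \<Sum>i<k. w j * d i)"
    by (rule sum.swap)
  also have "\<dots> = ruin_weight_sum p q k a * h k"
    by (simp add: ruin_weight_sum_def w_def sum_product flip: telescope)
  finally show ?thesis .
qed

text \<open>
  Here \<open>p = 0\<close> is separate because the only nonzero weight is then the last one, by \<open>0^0 = 1\<close>;
  for \<open>p > 0\<close> already the first weight is positive.
\<close>

lemma ruin_weight_sum_pos:
  assumes "0 \<le> p" "0 \<le> q" "p + q = 1" "0 < k"
  shows "0 < ruin_weight_sum p q k k"
proof (cases "p = 0")
  case True
  then have "0 < p ^ (k - Suc (k - 1)) * q ^ (k - 1)"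
    using assms by simp
  then show ?thesis
    unfolding ruin_weight_sum_def using assms by (intro sum_pos2[where i = "k - 1"]) auto
next
  case False
  then show ?thesis
    unfolding ruin_weight_sum_def using assms by (intro sum_pos2[where i = 0]) auto
qed

text \<open>
  A truncated geometric sum: the factor \<open>p - q\<close> makes it telescope, which is why the closed form
  degenerates exactly at \<open>p = q\<close>.
\<close>

lemma ruin_weight_sum_closed_form:
  fixes p q :: real
  assumes "a \<le> k"
  shows "(p - q) * ruin_weight_sum p q k a = p ^ (k - a) * (p ^ a - q ^ a)"
  using assms
proof (induction a)
  case (Suc a)
  have "k - a = Suc (k - Suc a)"
    using Suc.prems by simp
  with Suc show ?case
    by (simp add: ruin_weight_sum_def algebra_simps)
qed (simp add: ruin_weight_sum_def)

section \<open>Gambler's ruin for the walk\<close>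

text \<open>
  Asking for some time \<open>t\<close> before which the walk is strictly inside the segment, rather than
  comparing two hitting times, avoids hitting times that may be infinite.
\<close>

definition hits_before_0 :: "int \<Rightarrow> int \<Rightarrow> bool stream \<Rightarrow> bool" where
  "hits_before_0 m a w \<longleftrightarrow> (\<exists>t. walk a w t = m \<and> (\<forall>s<t. walk a w s \<in> {0<..<m}))"

lemma walk_0 [simp]: "walk a w 0 = a"
  by (simp add: walk_def)

lemma walk_Suc: "walk a w (Suc t) = walk a w t + (if w !! t then 1 else -1)"
  by (simp add: walk_def)

lemma walk_Cons_Suc: "walk a (b ## w) (Suc t) = walk (a + (if b then 1 else -1)) w t"
  unfolding walk_def sum.lessThan_Suc_shift by simp

lemma hits_before_0_at_0: "0 < m \<Longrightarrow> \<not> hits_before_0 m 0 w"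
proof
  assume "0 < m" "hits_before_0 m 0 w"
  then obtain t where t: "walk 0 w t = m" "\<forall>s<t. walk 0 w s \<in> {0<..<m}"
    by (auto simp: hits_before_0_def)
  with \<open>0 < m\<close> show False
    by (cases t) force+
qed

lemma hits_before_0_at_target: "hits_before_0 m m w"
  unfolding hits_before_0_def by (rule exI[of _ 0]) simp

text \<open>
  This is the pathwise form of conditioning on the first step; the start must lie strictly inside
  the segment, since otherwise the search has already been decided.
\<close>

lemma hits_before_0_Cons:
  assumes "0 < a" "a < m"
  shows "hits_before_0 m a (b ## w) \<longleftrightarrow> hits_before_0 m (a + (if b then 1 else -1)) w"
proof
  assume "hits_before_0 m a (b ## w)"
  then obtain t where t: "walk a (b ## w) t = m" "\<forall>s<t. walk a (b ## w) s \<in> {0<..<m}"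
    by (auto simp: hits_before_0_def)
  with assms obtain t' where t': "t = Suc t'"
    by (cases t) auto
  have "walk (a + (if b then 1 else -1)) w s \<in> {0<..<m}" if "s < t'" for s
    using t(2) t' that by (metis Suc_less_eq walk_Cons_Suc)
  with t(1) t' show "hits_before_0 m (a + (if b then 1 else -1)) w"
    unfolding hits_before_0_def by (metis walk_Cons_Suc)
next
  assume "hits_before_0 m (a + (if b then 1 else -1)) w"
  then obtain t where t: "walk (a + (if b then 1 else -1)) w t = m"
      "\<forall>s<t. walk (a + (if b then 1 else -1)) w s \<in> {0<..<m}"
    unfolding hits_before_0_def by blast
  have "walk a (b ## w) s \<in> {0<..<m}" if "s < Suc t" for s
    using t(2) that assms by (cases s) (simp_all add: walk_Cons_Suc)
  with t(1) show "hits_before_0 m a (b ## w)"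
    unfolding hits_before_0_def by (metis walk_Cons_Suc)
qed

abbreviation step_stream :: "real \<Rightarrow> bool stream measure" where
  "step_stream p \<equiv> stream_space (measure_pmf (bernoulli_pmf p))"

lemma space_step_stream [simp]: "space (step_stream p) = UNIV"
  by (simp add: space_stream_space)

lemma prob_space_step_stream: "prob_space (step_stream p)"
  by (intro prob_space.prob_space_stream_space prob_space_measure_pmf)

lemma measurable_walk [measurable]:
  "(\<lambda>w. walk a w t) \<in> measurable (step_stream p) (count_space UNIV)"
proof -
  have [measurable]: "(\<lambda>w. w !! s) \<in> measurable (step_stream p) (count_space UNIV)" for s
    using measurable_snth[of s "measure_pmf (bernoulli_pmf p)"] by simp
  show ?thesis
  proof (induction t)
    case (Suc t)
    have shift: "(\<lambda>w. walk a w t + c) \<in> measurable (step_stream p) (count_space UNIV)" for c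
      by (rule measurable_compose[OF Suc]) simp
    have "(\<lambda>w. if w !! t then walk a w t + 1 else walk a w t + - 1)
        \<in> measurable (step_stream p) (count_space UNIV)"
      by (intro measurable_If shift) measurable
    also have "(\<lambda>w. if w !! t then walk a w t + 1 else walk a w t + - 1) = (\<lambda>w. walk a w (Suc t))"
      by (simp add: walk_Suc fun_eq_iff)
    finally show ?case .
  qed simp
qed

lemma sets_hits_before_0 [measurable]: "{w. hits_before_0 m a w} \<in> sets (step_stream p)"
proof -
  have [measurable]: "Measurable.pred (step_stream p) (\<lambda>w. walk a w t \<in> A)" for t A
    by (rule measurable_compose[OF measurable_walk]) simp
  have "Measurable.pred (step_stream p) (\<lambda>w. \<exists>t. walk a w t \<in> {m} \<and>
      (\<forall>s\<in>{..<t}. walk a w s \<in> {0<..<m}))"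
    by (intro pred_intros_logic pred_intros_countable pred_intros_finite) simp_all
  then have "{w \<in> space (step_stream p). hits_before_0 m a w} \<in> sets (step_stream p)"
    by (simp add: hits_before_0_def pred_def Ball_def)
  then show ?thesis
    by simp
qed

definition hit_prob :: "real \<Rightarrow> int \<Rightarrow> int \<Rightarrow> real" where
  "hit_prob p m a = measure (step_stream p) {w. hits_before_0 m a w}"

lemma hit_prob_first_step:
  assumes "0 \<le> p" "p \<le> 1" "0 < a" "a < m"
  shows "hit_prob p m a = p * hit_prob p m (a + 1) + (1 - p) * hit_prob p m (a - 1)"
proof -
  have nonneg: "0 \<le> hit_prob p m b" for b
    by (simp add: hit_prob_def)
  have "ennreal (hit_prob p m a) =
      (\<integral>\<^sup>+b. measure (step_stream p) {w. hits_before_0 m a (b ## w)} \<partial>bernoulli_pmf p)"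
    using prob_space.prob_stream_space[OF prob_space_measure_pmf, of "bernoulli_pmf p" "hits_before_0 m a"]
    by (simp add: hit_prob_def sets_hits_before_0)
  also have "\<dots> = (\<integral>\<^sup>+b. hit_prob p m (a + (if b then 1 else -1)) \<partial>bernoulli_pmf p)"
    using assms by (simp only: hits_before_0_Cons hit_prob_def)
  also have "\<dots> = ennreal (p * hit_prob p m (a + 1) + (1 - p) * hit_prob p m (a - 1))"
    using assms nonneg
    by (simp add: ennreal_mult' ennreal_plus mult.commute flip: ennreal_1 ennreal_minus)
  finally show ?thesis
    using assms nonneg by (subst (asm) ennreal_inj) auto
qed

lemma hit_prob_at_0: "0 < m \<Longrightarrow> hit_prob p m 0 = 0"
  by (simp add: hit_prob_def hits_before_0_at_0)

lemma hit_prob_at_target: "hit_prob p m m = 1"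
  using prob_space.prob_space[OF prob_space_step_stream, of p]
  by (simp add: hit_prob_def hits_before_0_at_target)

lemma hit_prob_eq_ruin_weight_quotient:
  assumes p: "0 \<le> p" "p \<le> 1" and a: "a \<le> k" and k: "0 < k"
  shows "hit_prob p (int k) (int a) =
    ruin_weight_sum p (1 - p) k a / ruin_weight_sum p (1 - p) k k"
proof -
  have "ruin_weight_sum p (1 - p) k k * hit_prob p (int k) (int a) =
      ruin_weight_sum p (1 - p) k a * hit_prob p (int k) (int k)"
  proof (rule harmonic_on_segment)
    fix b assume "0 < b" "b < k"
    then show "hit_prob p (int k) (int b) =
        p * hit_prob p (int k) (int (Suc b)) + (1 - p) * hit_prob p (int k) (int (b - 1))"
      using hit_prob_first_step[OF p, of "int b" "int k"] by (simp add: of_nat_diff add.commute)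
  qed (use a k hit_prob_at_0 in auto)
  moreover have "0 < ruin_weight_sum p (1 - p) k k"
    using p k by (intro ruin_weight_sum_pos) auto
  ultimately show ?thesis
    by (simp add: hit_prob_at_target field_simps)
qed

lemma hit_prob_fair:
  assumes "a \<le> k" "0 < k"
  shows "hit_prob (1 / 2) (int k) (int a) = real a / real k"
proof -
  have "ruin_weight_sum (1 / 2) (1 / 2) k b = real b * (1 / 2) ^ (k - 1)" if "b \<le> k" for b
  proof -
    have "ruin_weight_sum (1 / 2) (1 / 2) k b = (\<Sum>j<b. (1 / 2) ^ (k - 1))"
      unfolding ruin_weight_sum_def
      using that by (intro sum.cong refl) (simp flip: power_add)
    then show ?thesis
      by simp
  qed
  then show ?thesis
    using assms by (simp add: hit_prob_eq_ruin_weight_quotient)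
qed

lemma hit_prob_biased:
  assumes "0 \<le> p" "p \<le> 1" "p \<noteq> 1 / 2" "a \<le> k" "0 < k" and q: "q = 1 - p"
  shows "hit_prob p (int k) (int a) = p ^ (k - a) * ((p ^ a - q ^ a) / (p ^ k - q ^ k))"
proof -
  have "p - q \<noteq> 0"
    using assms by auto
  then have "hit_prob p (int k) (int a) =
      ((p - q) * ruin_weight_sum p q k a) / ((p - q) * ruin_weight_sum p q k k)"
    using assms by (simp add: hit_prob_eq_ruin_weight_quotient)
  then show ?thesis
    using assms(4) by (simp add: ruin_weight_sum_closed_form)
qed

section \<open>Parking behind a full initial segment\<close>

text \<open>
  The street may be longer than \<open>i + 1\<close>, but the walk moves by unit steps from a start in
  \<open>{1..i + 1}\<close>, so where it first leaves \<open>{1..i}\<close> it cannot be beyond \<open>i + 1\<close>.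
\<close>

lemma park_behind_full_segment:
  assumes "1 \<le> a" "a \<le> int i + 1" "Suc i \<le> n"
  shows "park n {1..int i} a w =
    (if hits_before_0 (int i + 1) a w then Some (int i + 1) else None)"
proof -
  have ends: "search_ends n {1..int i} x \<longleftrightarrow> x \<notin> {1..int i}" for x
    using assms by (auto simp: search_ends_def)
  show ?thesis
  proof (cases "\<exists>t. walk a w t \<notin> {1..int i}")
    case False
    then have "\<not> hits_before_0 (int i + 1) a w"
      by (metis add_le_same_cancel1 atLeastAtMost_iff hits_before_0_def not_one_le_zero)
    with False show ?thesis
      by (simp add: park_def ends)
  next
    case True
    define T where "T = (LEAST t. walk a w t \<notin> {1..int i})"
    have T: "walk a w T \<notin> {1..int i}"
      unfolding T_def using True by (rule LeastI_ex)
    have before: "walk a w s \<in> {1..int i}" if "s < T" for s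
      using not_less_Least[OF that[unfolded T_def]] by simp
    have le: "walk a w T \<le> int i + 1"
    proof (cases T)
      case (Suc s)
      then show ?thesis
        using before[of s] by (auto simp: walk_Suc)
    qed (use assms in simp)
    have "park n {1..int i} a w = (if walk a w T \<in> {1..int n} then Some (walk a w T) else None)"
      using True by (simp add: park_def ends T_def Let_def)
    moreover have "walk a w T \<in> {1..int n} \<longleftrightarrow> walk a w T = int i + 1"
      using T le assms by auto
    moreover have "hits_before_0 (int i + 1) a w \<longleftrightarrow> walk a w T = int i + 1"
    proof
      assume "hits_before_0 (int i + 1) a w"
      then obtain t where t: "walk a w t = int i + 1" "\<forall>s<t. walk a w s \<in> {0<..<int i + 1}"
        by (auto simp: hits_before_0_def)
      have "t = T"
      proof (rule linorder_cases)
        assume "t < T"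
        with before[of t] t(1) show ?thesis by simp
      next
        assume "T < t"
        with t(2) T show ?thesis by force
      qed
      with t show "walk a w T = int i + 1" by simp
    next
      assume "walk a w T = int i + 1"
      then show "hits_before_0 (int i + 1) a w"
        unfolding hits_before_0_def using before by (intro exI[of _ T]) force
    qed
    ultimately show ?thesis
      by simp
  qed
qed

lemma car_parks_behind_full_segment:
  assumes "occupied n \<alpha> \<omega> i = {1..int i}" "\<alpha> (Suc i) \<in> {1..Suc i}" "Suc i \<le> n"
  shows "car_parks n \<alpha> \<omega> (Suc i) \<longleftrightarrow>
    hits_before_0 (int (Suc i)) (int (\<alpha> (Suc i))) (\<omega> (Suc i))"
  using assms park_behind_full_segment[of "int (\<alpha> (Suc i))" i n "\<omega> (Suc i)"]
  by (simp add: car_parks_def add.commute)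

lemma occupied_if_all_park:
  assumes "\<forall>k\<in>{1..n}. \<alpha> k \<in> {1..k}" "i \<le> n" "\<forall>k\<in>{1..i}. car_parks n \<alpha> \<omega> k"
  shows "occupied n \<alpha> \<omega> i = {1..int i}"
  using assms(2,3)
proof (induction i)
  case (Suc i)
  then have occ: "occupied n \<alpha> \<omega> i = {1..int i}"
    by simp
  have \<alpha>: "\<alpha> (Suc i) \<in> {1..Suc i}"
    using assms(1) Suc.prems by auto
  have "car_parks n \<alpha> \<omega> (Suc i)"
    using Suc.prems by simp
  then have "park n {1..int i} (int (\<alpha> (Suc i))) (\<omega> (Suc i)) = Some (int i + 1)"
    using park_behind_full_segment[of "int (\<alpha> (Suc i))" i n "\<omega> (Suc i)"] \<alpha> Suc.prems occ
    by (simp add: car_parks_def split: if_splits)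
  then show ?case
    using occ by auto
qed simp

text \<open>
  The equivalence is proved by induction along prefixes of the cars: what \<open>car_parks\<close> says
  about car \<open>m + 1\<close> depends on the earlier cars, and it reduces to a condition on the walk of car
  \<open>m + 1\<close> alone only when all of them have parked.
\<close>

lemma all_park_iff_all_hit:
  assumes \<alpha>: "\<forall>k\<in>{1..n}. \<alpha> k \<in> {1..k}"
  shows "(\<forall>k\<in>{1..n}. car_parks n \<alpha> \<omega> k) \<longleftrightarrow>
    (\<forall>k\<in>{1..n}. hits_before_0 (int k) (int (\<alpha> k)) (\<omega> k))"
proof -
  have "(\<forall>k\<in>{1..m}. car_parks n \<alpha> \<omega> k) \<longleftrightarrow>
      (\<forall>k\<in>{1..m}. hits_before_0 (int k) (int (\<alpha> k)) (\<omega> k))" if "m \<le> n" for m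
    using that
  proof (induction m)
    case (Suc m)
    have split: "(\<forall>k\<in>{1..Suc m}. P k) \<longleftrightarrow> (\<forall>k\<in>{1..m}. P k) \<and> P (Suc m)" for P
      by (simp add: atLeastAtMostSuc_conv conj_commute)
    have "car_parks n \<alpha> \<omega> (Suc m) \<longleftrightarrow>
        hits_before_0 (int (Suc m)) (int (\<alpha> (Suc m))) (\<omega> (Suc m))"
      if "\<forall>k\<in>{1..m}. car_parks n \<alpha> \<omega> k"
      using that \<alpha> Suc.prems
      by (intro car_parks_behind_full_segment occupied_if_all_park) auto
    with Suc show ?case
      unfolding split by auto
  qed simp
  then show ?thesis
    by simp
qed

section \<open>The probability that all cars park\<close>

text \<open>
  By \<open>all_park_iff_all_hit\<close> the event is a box in the product space, which is how the
  independence of the walks enters.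
\<close>

lemma prob_all_park_eq_prod_hit_prob:
  assumes "\<forall>k\<in>{1..n}. \<alpha> k \<in> {1..k}"
  shows "\<P>(\<omega> in steps_space n p. X n \<alpha> \<omega> = 1) = (\<Prod>k = 1..n. hit_prob p (int k) (int (\<alpha> k)))"
proof -
  interpret finite_product_prob_space "\<lambda>_. step_stream p" "{1..n}"
    by (intro finite_product_prob_space.intro finite_product_sigma_finite.intro
        finite_product_sigma_finite_axioms.intro product_prob_spaceI
        product_prob_space.axioms(1) prob_space_step_stream) simp
  have "{\<omega> \<in> space (steps_space n p). X n \<alpha> \<omega> = 1} =
      (\<Pi>\<^sub>E k\<in>{1..n}. {w. hits_before_0 (int k) (int (\<alpha> k)) w})"
    using all_park_iff_all_hit[OF assms]
    by (auto simp: X_def steps_space_def space_PiM PiE_iff extensional_def)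
  then show ?thesis
    using prob_times[of "\<lambda>k. {w. hits_before_0 (int k) (int (\<alpha> k)) w}"]
    by (simp add: steps_space_def hit_prob_def sets_hits_before_0)
qed

theorem corollary4p2:
  fixes n :: nat and p q :: real and \<alpha> :: "nat \<Rightarrow> nat"
  assumes "p \<in> {0..1}"
    and "q = 1 - p"
    and "\<forall>i\<in>{1..n}. \<alpha> i \<in> {1..n}"
    and "\<forall>i\<in>{1..n}. \<alpha> i \<le> i"
  shows "\<P>(\<omega> in steps_space n p. X n \<alpha> \<omega> = 1) =
    (if p = 1 / 2
     then \<Prod>k = 1..n. real (\<alpha> k) / real k
     else \<Prod>k = 1..n. p ^ (k - \<alpha> k) * ((p ^ \<alpha> k - q ^ \<alpha> k) / (p ^ k - q ^ k)))"
proof -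
  have \<alpha>: "\<forall>k\<in>{1..n}. \<alpha> k \<in> {1..k}"
    using assms(3,4) by auto
  show ?thesis
  proof (cases "p = 1 / 2")
    case True
    have "hit_prob p (int k) (int (\<alpha> k)) = real (\<alpha> k) / real k" if "k \<in> {1..n}" for k
      unfolding True using that \<alpha> by (intro hit_prob_fair) auto
    with True show ?thesis
      unfolding prob_all_park_eq_prod_hit_prob[OF \<alpha>] by simp
  next
    case False
    then have "hit_prob p (int k) (int (\<alpha> k)) =
        p ^ (k - \<alpha> k) * ((p ^ \<alpha> k - q ^ \<alpha> k) / (p ^ k - q ^ k))" if "k \<in> {1..n}" for k
      using that \<alpha> assms(1,2) by (intro hit_prob_biased) auto
    with False show ?thesis
      unfolding prob_all_park_eq_prod_hit_prob[OF \<alpha>] by simp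
  qed
qed

end
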